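(* Let $d$ be a positive integer and let $\varphi\in\Phi_d$ possess a $d$-radial spectral density $f_d$. Let $b_1,b_2\ge 0$ be scalars and let $\mathbf{A}_1,\mathbf{A}_2$ be symmetric positive definite real $d\times d$ matrices. Then the mapping $$\bm{h}\mapsto b_1\,\varphi\left(\sqrt{\bm{h}^\top \mathbf{A}_1\bm{h}}\right)-b_2\,\varphi\left(\sqrt{\bm{h}^\top \mathbf{A}_2\bm{h}}\right),\qquad \bm{h}\in\mathbb{R}^d,$$ is a stationary covariance function in $\mathbb{R}^d$ if and only if $$b_1\ \ge\ b_2\,\frac{|\mathbf{A}_1|^{1/2}}{|\mathbf{A}_2|^{1/2}}\ \sup_{\bm{\omega}\in\mathbb{R}^d}\frac{f_d\left(\sqrt{\bm{\omega}^\top \mathbf{A}_2^{-1}\bm{\omega}}\right)}{f_d\left(\sqrt{\bm{\omega}^\top \mathbf{A}_1^{-1}\bm{\omega}}\right)}.$$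
   Context: A function $C:\mathbb{R}^d\to\mathbb{R}$ is a stationary covariance function in $\mathbb{R}^d$ if $(\bm{x},\bm{x}')\mapsto C(\bm{x}-\bm{x}')$ is the covariance function of a second-order zero-mean random field on $\mathbb{R}^d$, i.e. is (symmetric) positive semidefinite: $\sum_{i,j=1}^n v_iv_jC(\bm{x}_i-\bm{x}_j)\ge 0$ for all $n\in\mathbb{N}$, $v_1,\dots,v_n\in\mathbb{R}$, $\bm{x}_1,\dots,\bm{x}_n\in\mathbb{R}^d$. The class $\Phi_d$ is the set of continuous functions $\varphi:[0,\infty)\to\mathbb{R}$ such that $(\bm{x},\bm{x}')\mapsto\varphi(\|\bm{x}-\bm{x}'\|)$ is positive semidefinite on $\mathbb{R}^d\times\mathbb{R}^d$ ($\|\cdot\|$ is the Euclidean norm). By Bochner's theorem, $\varphi(\|\bm{h}\|)=\int_{\mathbb{R}^d}\exp(\imath\bm{h}^\top\bm{\omega})F(\mathrm{d}\bm{\omega})$ for a nonnegative finite measure $F$. If $F$ is absolutely continuous with respect to Lebesgue measure, $F(\mathrm{d}\bm{\omega})=f(\bm{\omega})\,\mathrm{d}\bm{\omega}$ with spectral density $f:\mathbb{R}^d\to\mathbb{R}$ given by Fourier inversion $f(\bm{\omega})=(2\pi)^{-d}\int_{\mathbb{R}^d}\exp(-\imath\bm{\omega}^\top\bm{h})\varphi(\|\bm{h}\|)\,\mathrm{d}\bm{h}$, one says that $\varphi$ possesses a $d$-radial spectral density, namely the function $f_d$ on $[0,\infty)$ with $f(\bm{\omega})=f_d(\|\bm{\omega}\|)$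 for all $\bm{\omega}\in\mathbb{R}^d$. $|\mathbf{A}|$ denotes the determinant of a square matrix $\mathbf{A}$. *)

theory Defs
  imports "HOL-Analysis.Analysis"
begin

definition psd_kernel :: "('a \<Rightarrow> 'a \<Rightarrow> real) \<Rightarrow> bool" where
  "psd_kernel K \<longleftrightarrow>
     (\<forall>x y. K x y = K y x) \<and>
     (\<forall>(n::nat) (v :: nat \<Rightarrow> real) (x :: nat \<Rightarrow> 'a).
        (\<Sum>i<n. \<Sum>j<n. v i * v j * K (x i) (x j)) \<ge> 0)"

definition stationary_covariance :: "(real ^ 'd \<Rightarrow> real) \<Rightarrow> bool" where
  "stationary_covariance C \<longleftrightarrow> psd_kernel (\<lambda>x y. C (x - y))"

text \<open>The class \<open>\<Phi>\<^sub>d\<close>, with \<open>d = CARD('d)\<close>. Its members are functions on \<open>[0,\<infinity>)\<close>;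
  here they are functions on \<^typ>\<open>real\<close> whose values at negative arguments play no role.\<close>

definition Phi :: "'d::finite itself \<Rightarrow> (real \<Rightarrow> real) set" where
  "Phi _ = {\<phi>. continuous_on {0..} \<phi> \<and>
                psd_kernel (\<lambda>x y :: real ^ 'd. \<phi> (norm (x - y)))}"

definition spectral_measure :: "(real \<Rightarrow> real) \<Rightarrow> (real ^ 'd) measure \<Rightarrow> bool" where
  "spectral_measure \<phi> F \<longleftrightarrow>
     sets F = sets borel \<and> finite_measure F \<and>
     (\<forall>h. complex_of_real (\<phi> (norm h)) = (LINT \<omega>|F. exp (\<i> * complex_of_real (h \<bullet> \<omega>))))"

text \<open>A spectral density is a density of the spectral measure that is given at every point by
  Fourier inversion. Integrability is required explicitly because the Bochner integral of a
  non-integrable function is \<open>0\<close> by convention. As the inversion formula fixes the values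
  pointwise, suprema over all frequencies do not depend on a choice of representative.\<close>

definition spectral_density :: "(real \<Rightarrow> real) \<Rightarrow> (real ^ 'd \<Rightarrow> real) \<Rightarrow> bool" where
  "spectral_density \<phi> f \<longleftrightarrow>
     f \<in> borel_measurable borel \<and> (\<forall>\<omega>. f \<omega> \<ge> 0) \<and>
     spectral_measure \<phi> (density lborel (\<lambda>\<omega>. ennreal (f \<omega>))) \<and>
     integrable lborel (\<lambda>h :: real ^ 'd. \<phi> (norm h)) \<and>
     (\<forall>\<omega>. complex_of_real (f \<omega>) =
        complex_of_real (1 / (2 * pi) ^ CARD('d)) *
        (LINT h|lborel. exp (- \<i> * complex_of_real (\<omega> \<bullet> h)) * complex_of_real (\<phi> (norm h))))"

definition radial_spectral_density ::
    "'d::finite itself \<Rightarrow> (real \<Rightarrow> real) \<Rightarrow> (real \<Rightarrow> real) \<Rightarrow> bool" where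
  "radial_spectral_density _ \<phi> fd \<longleftrightarrow> spectral_density \<phi> (\<lambda>\<omega> :: real ^ 'd. fd (norm \<omega>))"

definition sym_pos_def :: "real ^ 'd ^ 'd \<Rightarrow> bool" where
  "sym_pos_def A \<longleftrightarrow> transpose A = A \<and> (\<forall>x. x \<noteq> 0 \<longrightarrow> x \<bullet> (A *v x) > 0)"

text \<open>The supremum is taken in the extended reals, since the ratio may be unbounded and the
  denominator may vanish. Division on \<^typ>\<open>ereal\<close> satisfies \<open>c / 0 = \<infinity>\<close> for \<open>c > 0\<close> and
  \<open>0 / 0 = 0\<close>, so frequencies at which both densities vanish impose no constraint. Moreover
  \<open>0 * \<infinity> = 0\<close>, which is relevant when this supremum is multiplied by a coefficient \<open>0\<close>.\<close>

definition sup_density_ratio ::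
    "(real \<Rightarrow> real) \<Rightarrow> real ^ 'd ^ 'd \<Rightarrow> real ^ 'd ^ 'd \<Rightarrow> ereal" where
  "sup_density_ratio fd A1 A2 =
     (SUP \<omega>. ereal (fd (sqrt (\<omega> \<bullet> (matrix_inv A2 *v \<omega>)))) /
             ereal (fd (sqrt (\<omega> \<bullet> (matrix_inv A1 *v \<omega>)))))"

end

theory Submission
  imports Defs "HOL-Real_Asymp.Real_Asymp"
begin

text \<open>
  A linear substitution in the Fourier integral shows that \<open>h \<mapsto> \<phi> (\<surd>(h \<bullet> A h))\<close> has the spectral
  density \<open>\<omega> \<mapsto> f\<^sub>d (\<surd>(\<omega> \<bullet> A\<^sup>-\<^sup>1 \<omega>)) / \<surd>(det A)\<close> (\<open>anisotropic_spectral_density\<close>). By linearity the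
  difference in question is the Fourier integral of an integrable signed function \<open>g\<close>. This \<open>g\<close> is
  continuous, since the inversion formula exhibits \<open>f\<^sub>d\<close> as a Fourier integral of an integrable
  function. A Fourier integral of such a \<open>g\<close> is positive semidefinite if and only if \<open>g\<close> is nonnegative at
  every frequency (\<open>psd_char_integral_iff\<close>), and solving \<open>g \<omega> \<ge> 0\<close> for \<open>b\<^sub>1\<close> gives the bound by the
  supremum of the ratio (\<open>ereal_SUP_ratio_le_iff\<close>).

  The necessity of \<open>g \<ge> 0\<close> is proved on the frequency side, without Fourier inversion of the
  difference. Positive semidefiniteness says that \<open>\<integral> \<bar>p\<bar>\<^sup>2 g \<ge> 0\<close> for every trigonometric polynomial \<open>p\<close>.
  Products of powers of cosines converge boundedly to Gaussians with any centre and any width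
  (\<open>cos_pow_tendsto_gaussian\<close>), so Gaussian averages of \<open>g\<close> are nonnegative
  (\<open>gaussian_integral_nonneg\<close>), and letting the width shrink yields the value of \<open>g\<close> at the centre.

  The substitution uses a matrix \<open>V\<close> with \<open>V\<^sup>T A V = 1\<close>, obtained by Gram-Schmidt
  (\<open>pos_def_whitening\<close>), and the change of variables formula for invertible matrices indexed by an
  arbitrary finite type (\<open>nn_integral_lborel_matrix\<close>).
\<close>

section \<open>Whitening a positive definite matrix\<close>

lemma sym_matrix_inner_commute:
  fixes A :: "real ^ 'n ^ 'n"
  assumes "transpose A = A"
  shows "x \<bullet> (A *v y) = y \<bullet> (A *v x)"
  by (metis assms dot_lmul_matrix inner_commute transpose_matrix_vector)

text \<open>Gram-Schmidt for the inner product \<open>(x, y) \<mapsto> x \<bullet> A y\<close>. The vectors are indexed by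
  coordinates, so that for \<open>S = UNIV\<close> they are the columns of a square matrix.\<close>

lemma pos_def_orthonormal_family:
  fixes A :: "real ^ 'n ^ 'n"
  assumes A: "sym_pos_def A" and "finite S"
  shows "\<exists>v :: 'n \<Rightarrow> real ^ 'n. \<forall>i\<in>S. \<forall>j\<in>S. v i \<bullet> (A *v v j) = of_bool (i = j)"
  using \<open>finite S\<close>
proof (induction S)
  case empty
  then show ?case by simp
next
  case (insert k S)
  have sym: "x \<bullet> (A *v y) = y \<bullet> (A *v x)" for x y
    using A sym_matrix_inner_commute by (auto simp: sym_pos_def_def)
  obtain v :: "'n \<Rightarrow> real ^ 'n"
    where v: "\<And>i j. i \<in> S \<Longrightarrow> j \<in> S \<Longrightarrow> v i \<bullet> (A *v v j) = of_bool (i = j)"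
    using insert.IH by blast
  have "dim (v ` S) \<le> card (v ` S)"
    using insert.hyps by (intro dim_le_card') auto
  also have "\<dots> \<le> card S"
    using insert.hyps by (intro card_image_le)
  also have "\<dots> < card (insert k S)"
    using insert.hyps by simp
  also have "\<dots> \<le> CARD('n)"
    by (intro card_mono) auto
  finally have "dim (v ` S) < DIM(real ^ 'n)"
    by simp
  then have "span (v ` S) \<noteq> UNIV"
    using dim_eq_full[of "v ` S"] by auto
  then obtain x where x: "x \<notin> span (v ` S)"
    by blast
  \<comment> \<open>The component of \<open>x\<close> that is \<open>A\<close>-orthogonal to the vectors found so far.\<close>
  define y where "y = x - (\<Sum>i\<in>S. (v i \<bullet> (A *v x)) *\<^sub>R v i)"
  have "(\<Sum>i\<in>S. (v i \<bullet> (A *v x)) *\<^sub>R v i) \<in> span (v ` S)"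
    by (intro span_sum span_mul span_base) auto
  with x have "y \<noteq> 0"
    by (auto simp: y_def)
  then have pos: "y \<bullet> (A *v y) > 0"
    using A by (simp add: sym_pos_def_def)
  have orth: "y \<bullet> (A *v v j) = 0" if "j \<in> S" for j
  proof -
    have "(\<Sum>i\<in>S. (v i \<bullet> (A *v x)) * (v i \<bullet> (A *v v j))) =
          (\<Sum>i\<in>S. if i = j then v i \<bullet> (A *v x) else 0)"
      by (intro sum.cong) (auto simp: v that)
    then show ?thesis
      using that insert.hyps sym[of x "v j"]
      by (simp add: y_def inner_diff_left inner_sum_left)
  qed
  define w where "w = v(k := (1 / sqrt (y \<bullet> (A *v y))) *\<^sub>R y)"
  have "w i \<bullet> (A *v w j) = of_bool (i = j)" if "i \<in> insert k S" "j \<in> insert k S" for i j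
    using that insert.hyps v pos orth sym[of "v i" y]
    by (auto simp: w_def matrix_vector_mult_scaleR real_sqrt_mult_self field_simps)
  then show ?case
    by blast
qed

text \<open>A one-sided substitute for the square root of \<open>A\<close>: the columns of \<open>V\<close> form an
  \<open>A\<close>-orthonormal basis, so \<open>V\<close> plays the role of \<open>A\<^sup>-\<^sup>1\<^sup>/\<^sup>2\<close>.\<close>

lemma pos_def_whitening:
  fixes A :: "real ^ 'n ^ 'n"
  assumes "sym_pos_def A"
  obtains V :: "real ^ 'n ^ 'n" where "transpose V ** A ** V = mat 1"
proof -
  obtain v :: "'n \<Rightarrow> real ^ 'n" where v: "\<And>i j. v i \<bullet> (A *v v j) = of_bool (i = j)"
    using pos_def_orthonormal_family[OF assms, of UNIV] by auto
  define V where "V = (\<chi> i j. v j $ i)"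
  have "(transpose V ** (A ** V)) $ i $ j = v i \<bullet> (A *v v j)" for i j
    by (simp add: V_def matrix_matrix_mult_def transpose_def matrix_vector_mult_def inner_vec_def)
  then have "transpose V ** A ** V = mat 1"
    by (simp add: vec_eq_iff v mat_def matrix_mul_assoc)
  then show ?thesis
    by (rule that)
qed

lemma whitening_properties:
  fixes A V :: "real ^ 'n ^ 'n"
  assumes "transpose V ** A ** V = mat 1"
  shows "det A * (det V)\<^sup>2 = 1" and "matrix_inv A = V ** transpose V"
    and "u \<bullet> u = (V *v u) \<bullet> (A *v (V *v u))"
proof -
  have "det (transpose V ** A ** V) = 1"
    using assms by simp
  then show "det A * (det V)\<^sup>2 = 1"
    by (simp add: det_mul power2_eq_square mult_ac)
  have "V ** (transpose V ** A) = mat 1"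
    using assms matrix_left_right_inverse by blast
  then have l: "(V ** transpose V) ** A = mat 1"
    by (simp add: matrix_mul_assoc)
  then have r: "A ** (V ** transpose V) = mat 1"
    using matrix_left_right_inverse by blast
  have "A ** matrix_inv A = mat 1 \<and> matrix_inv A ** A = mat 1"
    unfolding matrix_inv_def by (rule someI_ex) (use l r in blast)
  then show "matrix_inv A = V ** transpose V"
    by (metis l matrix_mul_assoc matrix_mul_lid matrix_mul_rid)
  have "(V *v u) \<bullet> (A *v (V *v u)) = u \<bullet> ((transpose V ** A ** V) *v u)"
    by (metis dot_lmul_matrix matrix_vector_mul_assoc transpose_matrix_vector transpose_transpose)
  then show "u \<bullet> u = (V *v u) \<bullet> (A *v (V *v u))"
    using assms by simp
qed

lemma sym_pos_def_det_pos:
  fixes A :: "real ^ 'n ^ 'n"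
  assumes "sym_pos_def A"
  shows "det A > 0"
proof -
  obtain V :: "real ^ 'n ^ 'n" where "transpose V ** A ** V = mat 1"
    using pos_def_whitening[OF assms] .
  then have "det A * (det V)\<^sup>2 = 1"
    by (rule whitening_properties)
  then show ?thesis
    by (metis not_less zero_le_power2 mult_nonpos_nonneg not_one_le_zero)
qed

section \<open>Linear change of variables for Lebesgue measure\<close>

lemma continuous_on_matrix_vector:
  fixes A :: "real ^ 'n ^ 'm"
  shows "continuous_on S ((*v) A)"
  by (intro linear_continuous_on) (simp add: linear_linear)

lemma borel_measurable_matrix_vector [measurable]:
  fixes A :: "real ^ 'n ^ 'm"
  shows "(*v) A \<in> borel \<rightarrow>\<^sub>M borel"
  by (intro borel_measurable_continuous_onI continuous_on_matrix_vector)

text \<open>Fubini: once the other coordinates are fixed, the shear translates the coordinate \<open>e\<close> by an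
  amount that does not depend on it.\<close>

lemma nn_integral_lborel_shear:
  fixes e c :: "'a::euclidean_space" and g :: "'a \<Rightarrow> ennreal"
  assumes e: "e \<in> Basis" and c: "c \<bullet> e = 0" and [measurable]: "g \<in> borel_measurable borel"
  shows "(\<integral>\<^sup>+x. g (x + (x \<bullet> c) *\<^sub>R e) \<partial>lborel) = (\<integral>\<^sup>+x. g x \<partial>lborel)"
proof -
  interpret product_sigma_finite "\<lambda>_ :: 'a. lborel :: real measure" ..
  let ?B = "Basis - {e}"
  let ?s = "\<lambda>y. \<Sum>b\<in>?B. y b *\<^sub>R b :: 'a"
  have ins: "insert e ?B = Basis"
    using e by auto
  have iterated: "(\<integral>\<^sup>+x. h x \<partial>lborel) = 
      (\<integral>\<^sup>+y. (\<integral>\<^sup>+t. h (t *\<^sub>R e + ?s y) \<partial>lborel) \<partial>Pi\<^sub>M ?B (\<lambda>_. lborel))"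
    if [measurable]: "h \<in> borel_measurable borel" for h :: "'a \<Rightarrow> ennreal"
  proof -
    have "(\<integral>\<^sup>+x. h x \<partial>lborel) = 
        (\<integral>\<^sup>+y. h (\<Sum>b\<in>Basis. y b *\<^sub>R b) \<partial>Pi\<^sub>M (insert e ?B) (\<lambda>_. lborel))"
      by (subst lborel_eq, subst nn_integral_distr) (simp_all only: ins, simp_all)
    also have "\<dots> = (\<integral>\<^sup>+y. (\<integral>\<^sup>+t. h (\<Sum>b\<in>Basis. (y(e := t)) b *\<^sub>R b) \<partial>lborel) 
                          \<partial>Pi\<^sub>M ?B (\<lambda>_. lborel))"
      by (rule product_nn_integral_insert) (auto simp: ins)
    also have "(\<lambda>y t. \<Sum>b\<in>Basis. (y(e := t)) b *\<^sub>R b) = (\<lambda>y t. t *\<^sub>R e + ?s y)"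
      by (intro ext, subst sum.remove[OF _ e]) (auto intro!: sum.cong)
    finally show ?thesis .
  qed
  have shifted: "t *\<^sub>R e + ?s y + ((t *\<^sub>R e + ?s y) \<bullet> c) *\<^sub>R e = 
      (?s y \<bullet> c + 1 * t) *\<^sub>R e + ?s y" for t y
    using c by (simp add: inner_add_left inner_commute algebra_simps)
  have "(\<integral>\<^sup>+t. g ((u + 1 * t) *\<^sub>R e + z) \<partial>lborel) = (\<integral>\<^sup>+t. g (t *\<^sub>R e + z) \<partial>lborel)"
    for u z
    using nn_integral_real_affine[of "\<lambda>t. g (t *\<^sub>R e + z)" 1 u] by simp
  then show ?thesis
    by (simp only: iterated[OF assms(3)] shifted iterated[of "\<lambda>x. g (x + (x \<bullet> c) *\<^sub>R e)", simplified])
qed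

lemma bij_betw_axis_Basis: "bij_betw (\<lambda>i :: 'n. axis i 1) UNIV (Basis :: (real ^ 'n) set)"
  by (auto simp: bij_betw_def inj_on_def axis_eq_axis Basis_vec_def)

lemma lborel_distr_permute:
  fixes \<pi> :: "'n::finite \<Rightarrow> 'n"
  assumes "bij \<pi>"
  shows "distr lborel borel (\<lambda>x :: real ^ 'n. \<chi> i. x $ \<pi> i) = lborel"
proof (rule lborel_eqI[symmetric])
  let ?P = "\<lambda>x :: real ^ 'n. \<chi> i. x $ \<pi> i"
  let ?Q = "\<lambda>x :: real ^ 'n. \<chi> i. x $ inv \<pi> i"
  have [measurable]: "?P \<in> borel \<rightarrow>\<^sub>M borel"
    by (intro borel_measurable_continuous_onI continuous_intros)
  have prod_cart: "(\<Prod>b\<in>Basis. z \<bullet> b) = (\<Prod>i\<in>UNIV. z $ i)" for z :: "real ^ 'n"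
    by (simp add: prod.reindex_bij_betw[OF bij_betw_axis_Basis, symmetric] inner_axis)
  fix l u :: "real ^ 'n" assume lu: "\<And>b. b \<in> Basis \<Longrightarrow> l \<bullet> b \<le> u \<bullet> b"
  have le: "l $ i \<le> u $ i" for i
    using lu[of "axis i 1"] by (simp add: inner_axis axis_in_Basis_iff)
  have box: "?P -` box l u = box (?Q l) (?Q u)"
  proof (intro set_eqI)
    fix x :: "real ^ 'n"
    have "(\<forall>i. l $ i < x $ \<pi> i \<and> x $ \<pi> i < u $ i) \<longleftrightarrow> 
          (\<forall>j. l $ inv \<pi> j < x $ j \<and> x $ j < u $ inv \<pi> j)"
      by (metis assms bij_inv_eq_iff)
    then show "x \<in> ?P -` box l u \<longleftrightarrow> x \<in> box (?Q l) (?Q u)"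
      by (simp add: mem_box_cart)
  qed
  have "emeasure (distr lborel borel ?P) (box l u) = emeasure lborel (box (?Q l) (?Q u))"
    by (subst emeasure_distr) (auto simp: box)
  also have "\<dots> = (\<Prod>i\<in>UNIV. (u - l) $ inv \<pi> i)"
  proof (subst emeasure_lborel_box)
    fix b :: "real ^ 'n" assume "b \<in> Basis"
    then show "?Q l \<bullet> b \<le> ?Q u \<bullet> b"
      using le by (auto simp: Basis_vec_def inner_axis)
  qed (simp add: prod_cart)
  also have "(\<Prod>i\<in>UNIV. (u - l) $ inv \<pi> i) = (\<Prod>i\<in>UNIV. (u - l) $ i)"
    using assms by (intro prod.reindex_bij_betw bij_imp_bij_inv)
  finally show "emeasure (distr lborel borel ?P) (box l u) = (\<Prod>b\<in>Basis. (u - l) \<bullet> b)"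
    by (simp add: prod_cart)
qed simp

text \<open>The formula for a product of matrices follows from those for its factors, so it suffices to check elementary matrices: diagonal
  ones, transpositions of two coordinates, and shears.\<close>

lemma nn_integral_lborel_matrix:
  fixes A :: "real ^ 'n ^ 'n" and g :: "real ^ 'n \<Rightarrow> ennreal"
  assumes "det A \<noteq> 0" and "g \<in> borel_measurable borel"
  shows "\<bar>det A\<bar> * (\<integral>\<^sup>+x. g (A *v x) \<partial>lborel) = (\<integral>\<^sup>+x. g x \<partial>lborel)"
proof -
  define P where "P B \<longleftrightarrow> (det B \<noteq> 0 \<longrightarrow> (\<forall>h \<in> borel_measurable borel.
      ennreal \<bar>det B\<bar> * (\<integral>\<^sup>+x. h (B *v x) \<partial>lborel) = (\<integral>\<^sup>+x. h x \<partial>lborel)))"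
    for B :: "real ^ 'n ^ 'n"
  have "P A"
  proof (rule induct_matrix_elementary_alt)
    fix B C :: "real ^ 'n ^ 'n"
    assume B: "P B" and C: "P C"
    show "P (B ** C)"
      unfolding P_def
    proof (intro impI ballI)
      fix h :: "real ^ 'n \<Rightarrow> ennreal"
      assume nz: "det (B ** C) \<noteq> 0" and h[measurable]: "h \<in> borel_measurable borel"
      have "ennreal \<bar>det (B ** C)\<bar> * (\<integral>\<^sup>+x. h ((B ** C) *v x) \<partial>lborel) =
          ennreal \<bar>det B\<bar> * (ennreal \<bar>det C\<bar> * (\<integral>\<^sup>+x. h (B *v (C *v x)) \<partial>lborel))"
        by (simp add: det_mul abs_mult ennreal_mult mult.assoc matrix_vector_mul_assoc)
      also have "ennreal \<bar>det C\<bar> * (\<integral>\<^sup>+x. h (B *v (C *v x)) \<partial>lborel) = (\<integral>\<^sup>+x. h (B *v x) \<partial>lborel)"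
        using C nz unfolding P_def det_mul by (auto dest!: bspec[of _ _ "\<lambda>x. h (B *v x)"])
      also have "ennreal \<bar>det B\<bar> * \<dots> = (\<integral>\<^sup>+x. h x \<partial>lborel)"
        using B nz h unfolding P_def det_mul by auto
      finally show "ennreal \<bar>det (B ** C)\<bar> * (\<integral>\<^sup>+x. h ((B ** C) *v x) \<partial>lborel) = 
          (\<integral>\<^sup>+x. h x \<partial>lborel)" .
    qed
  next
    fix B :: "real ^ 'n ^ 'n" and i
    assume "row i B = 0"
    then show "P B"
      by (simp add: P_def det_zero_row)
  next
    fix B :: "real ^ 'n ^ 'n"
    assume diag: "\<And>i j. i \<noteq> j \<Longrightarrow> B $ i $ j = 0"
    show "P B"
      unfolding P_def
    proof (intro impI ballI)
      fix h :: "real ^ 'n \<Rightarrow> ennreal"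
      assume nz: "det B \<noteq> 0" and h[measurable]: "h \<in> borel_measurable borel"
      have det: "det B = (\<Prod>i\<in>UNIV. B $ i $ i)"
        using diag by (rule det_diagonal)
      \<comment> \<open>Scaling factors indexed by basis vectors, the form in which scalings of \<open>lborel\<close> are known.\<close>
      define c where "c b = b \<bullet> (B *v b)" for b
      have c_axis: "c (axis i 1) = B $ i $ i" for i
        by (simp add: c_def inner_axis' matrix_vector_mul_component inner_axis)
      have prod: "(\<Prod>b\<in>Basis. \<bar>c b\<bar>) = \<bar>det B\<bar>"
        by (simp add: prod.reindex_bij_betw[OF bij_betw_axis_Basis, symmetric] c_axis det abs_prod)
      have "B *v x = 0 + (\<Sum>b\<in>Basis. (c b * (x \<bullet> b)) *\<^sub>R b)" for x
      proof (subst vec_eq_iff, intro allI)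
        fix i
        have "(\<Sum>b\<in>Basis. (c b * (x \<bullet> b)) *\<^sub>R b) $ i = (\<Sum>j\<in>UNIV. B $ j $ j * x $ j * axis j 1 $ i)"
          by (simp add: sum.reindex_bij_betw[OF bij_betw_axis_Basis, symmetric] c_axis inner_axis)
        also have "\<dots> = (\<Sum>j\<in>UNIV. B $ i $ j * x $ j)"
          using diag by (intro sum.cong) (auto simp: axis_def)
        finally show "(B *v x) $ i = (0 + (\<Sum>b\<in>Basis. (c b * (x \<bullet> b)) *\<^sub>R b)) $ i"
          by (simp add: matrix_vector_mult_def)
      qed
      then have mult_eq: "(*v) B = (\<lambda>x. 0 + (\<Sum>b\<in>Basis. (c b * (x \<bullet> b)) *\<^sub>R b))"
        by (rule ext)
      have c_nz: "c b \<noteq> 0" if "b \<in> Basis" for b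
        using that nz prod by (metis abs_zero finite_Basis prod_zero abs_eq_0_iff)
      have eq: "lborel = density (distr lborel borel ((*v) B)) (\<lambda>_. ennreal \<bar>det B\<bar>)"
        unfolding mult_eq prod[symmetric] by (rule lborel_affine_euclidean) (rule c_nz)
      have "(\<integral>\<^sup>+x. h x \<partial>lborel) = ennreal \<bar>det B\<bar> * (\<integral>\<^sup>+x. h (B *v x) \<partial>lborel)"
        by (subst eq) (simp add: nn_integral_density nn_integral_distr nn_integral_cmult)
      then show "ennreal \<bar>det B\<bar> * (\<integral>\<^sup>+x. h (B *v x) \<partial>lborel) = (\<integral>\<^sup>+x. h x \<partial>lborel)" ..
    qed
  next
    fix m n :: 'n
    assume "m \<noteq> n"
    define B :: "real ^ 'n ^ 'n" where "B = (\<chi> i j. mat 1 $ i $ Transposition.transpose m n j)"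
    have "\<bar>det B\<bar> = 1"
      unfolding B_def by (subst det_permute_columns) 
        (simp_all add: permutes_swap_id sign_swap_id abs_mult)
    moreover have "B *v x = (\<chi> i. x $ Transposition.transpose m n i)" for x
    proof -
      have swap: "i = Transposition.transpose m n j \<longleftrightarrow> j = Transposition.transpose m n i" for i j
        by (metis transpose_involutory)
      have "(B *v x) $ i = (\<Sum>j\<in>UNIV. if j = Transposition.transpose m n i then x $ j else 0)" for i
        unfolding B_def matrix_vector_mult_def mat_def vec_lambda_beta swap[of i]
        by (intro sum.cong) auto
      then show ?thesis
        by (simp add: vec_eq_iff)
    qed
    moreover have "(\<integral>\<^sup>+x. h (\<chi> i. x $ Transposition.transpose m n i) \<partial>lborel) = (\<integral>\<^sup>+x. h x \<partial>lborel)"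
      if [measurable]: "h \<in> borel_measurable borel" for h :: "real ^ 'n \<Rightarrow> ennreal"
    proof -
      have [measurable]: "(\<lambda>x :: real ^ 'n. \<chi> i. x $ Transposition.transpose m n i) \<in> borel \<rightarrow>\<^sub>M borel"
        by (intro borel_measurable_continuous_onI continuous_intros)
      show ?thesis
        by (subst (2) lborel_distr_permute[of "Transposition.transpose m n", symmetric])
           (simp_all add: nn_integral_distr)
    qed
    ultimately show "P (\<chi> i j. mat 1 $ i $ Transposition.transpose m n j)"
      unfolding P_def B_def[symmetric] by simp
  next
    fix m n :: 'n
    assume mn: "m \<noteq> n"
    define B :: "real ^ 'n ^ 'n" where "B = (\<chi> i j. of_bool (i = m \<and> j = n \<or> i = j))"
    have "B = (\<chi> k. if k = m then row m (mat 1) + 1 *s row n (mat 1) else row k (mat 1))"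
      using mn by (auto simp: B_def vec_eq_iff row_def mat_def)
    then have "det B = 1"
      using mn by (simp add: det_row_operation)
    moreover have "B *v x = x + (x \<bullet> axis n 1) *\<^sub>R axis m 1" for x
    proof -
      have "(B *v x) $ i = (x + (x \<bullet> axis n 1) *\<^sub>R axis m 1) $ i" for i
      proof -
        have "(B *v x) $ i = (\<Sum>j\<in>UNIV. (if j = i then x $ j else 0) + 
            (if j = n then of_bool (i = m) * x $ j else 0))"
          unfolding B_def matrix_vector_mult_def vec_lambda_beta using mn
          by (intro sum.cong) auto
        then show ?thesis
          unfolding inner_axis by (cases "i = m") (simp_all add: sum.distrib axis_def)
      qed
      then show ?thesis
        by (simp add: vec_eq_iff)
    qed
    moreover have "(\<integral>\<^sup>+x. h (x + (x \<bullet> axis n 1) *\<^sub>R axis m 1) \<partial>lborel) = (\<integral>\<^sup>+x. h x \<partial>lborel)"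
      if "h \<in> borel_measurable borel" for h :: "real ^ 'n \<Rightarrow> ennreal"
      using that mn by (intro nn_integral_lborel_shear) (auto simp: inner_axis_axis Basis_vec_def)
    ultimately show "P (\<chi> i j. of_bool (i = m \<and> j = n \<or> i = j))"
      unfolding P_def B_def[symmetric] by simp
  qed
  then show ?thesis
    using assms by (simp add: P_def)
qed

lemma lborel_eq_distr_matrix:
  fixes A :: "real ^ 'n ^ 'n"
  assumes "det A \<noteq> 0"
  shows "lborel = density (distr lborel borel ((*v) A)) (\<lambda>_. ennreal \<bar>det A\<bar>)"
proof (rule measure_eqI)
  fix X :: "(real ^ 'n) set" assume "X \<in> sets lborel"
  then have [measurable]: "X \<in> sets borel" by simp
  have "emeasure lborel X = (\<integral>\<^sup>+x. indicator X x \<partial>lborel)"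
    by simp
  also have "\<dots> = \<bar>det A\<bar> * (\<integral>\<^sup>+x. indicator X (A *v x) \<partial>lborel)"
    using assms by (intro nn_integral_lborel_matrix[symmetric]) auto
  also have "\<dots> = emeasure (density (distr lborel borel ((*v) A)) (\<lambda>_. ennreal \<bar>det A\<bar>)) X"
    by (simp add: emeasure_density nn_integral_distr nn_integral_cmult del: nn_integral_indicator)
  finally show "emeasure lborel X = emeasure (density (distr lborel borel ((*v) A)) (\<lambda>_. ennreal \<bar>det A\<bar>)) X" .
qed simp

lemma
  fixes A :: "real ^ 'n ^ 'n" and g :: "real ^ 'n \<Rightarrow> 'b :: {banach, second_countable_topology}"
  assumes "det A \<noteq> 0" and [measurable]: "g \<in> borel_measurable borel"
  shows integrable_lborel_matrix: "integrable lborel (\<lambda>x. g (A *v x)) \<longleftrightarrow> integrable lborel g"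
    and integral_lborel_matrix: 
      "(LINT x|lborel. g x) = \<bar>det A\<bar> *\<^sub>R (LINT x|lborel. g (A *v x))"
proof -
  show "integrable lborel (\<lambda>x. g (A *v x)) \<longleftrightarrow> integrable lborel g"
  proof -
    have "integrable lborel g \<longleftrightarrow> integrable lborel (\<lambda>x. \<bar>det A\<bar> *\<^sub>R g (A *v x))"
      using assms by (subst lborel_eq_distr_matrix[of A]) 
        (simp_all add: integrable_density integrable_distr_eq)
    also have "\<dots> \<longleftrightarrow> integrable lborel (\<lambda>x. g (A *v x))"
      using assms(1) integrable_scaleR_right[of "inverse \<bar>det A\<bar>" lborel "\<lambda>x. \<bar>det A\<bar> *\<^sub>R g (A *v x)"]
      by auto
    finally show ?thesis ..
  qed
  show "(LINT x|lborel. g x) = \<bar>det A\<bar> *\<^sub>R (LINT x|lborel. g (A *v x))"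
    using assms by (subst lborel_eq_distr_matrix[of A]) 
      (simp_all add: integral_density integral_distr)
qed

section \<open>Trigonometric polynomials\<close>

text \<open>Near \<open>0\<close> one has \<open>cos t \<approx> exp (- t\<^sup>2 / 2)\<close>. Scaling the argument by \<open>1 / \<surd>n\<close> also moves the other
  maxima of the periodic function off to infinity, so a Gaussian is a limit of trigonometric
  polynomials.\<close>

lemma cos_pow_tendsto_gaussian:
  fixes T y :: real
  assumes "T \<ge> 0"
  shows "(\<lambda>n. cos (sqrt (T / real n) * y) ^ n) \<longlonglongrightarrow> exp (- T * y\<^sup>2 / 2)"
proof (cases "T = 0 \<or> y = 0")
  case True
  then show ?thesis by auto
next
  case False
  define a where "a = sqrt T * y"
  have a: "a \<noteq> 0" using False assms by (auto simp: a_def)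
  have "(\<lambda>n. cos (a / sqrt (real n)) ^ n) \<longlonglongrightarrow> exp (- (a * a / 2))"
    using a by real_asymp
  also have "(\<lambda>n. cos (a / sqrt (real n)) ^ n) = (\<lambda>n. cos (sqrt (T / real n) * y) ^ n)"
    by (simp add: a_def real_sqrt_divide mult_ac)
  also have "a * a = T * y\<^sup>2"
    using assms by (simp add: a_def power2_eq_square)
  finally show ?thesis by simp
qed

text \<open>Generating the trigonometric polynomials from monomials by addition makes closure under products
  an easy induction; an explicit list of frequencies is recovered only at the end.\<close>

inductive_set trig_polys :: "('a :: euclidean_space \<Rightarrow> complex) set" where
  monomial: "(\<lambda>\<omega>. c * exp (\<i> * of_real (x \<bullet> \<omega>))) \<in> trig_polys"
| add: "p \<in> trig_polys \<Longrightarrow> q \<in> trig_polys \<Longrightarrow> (\<lambda>\<omega>. p \<omega> + q \<omega>) \<in> trig_polys"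

lemma trig_polys_const: "(\<lambda>_. c) \<in> trig_polys"
  using trig_polys.monomial[of c 0] by simp

lemma trig_polys_mult:
  assumes "p \<in> trig_polys" "q \<in> trig_polys"
  shows "(\<lambda>\<omega>. p \<omega> * q \<omega>) \<in> trig_polys"
  using assms
proof (induction p rule: trig_polys.induct)
  case (monomial c x)
  from monomial show ?case
  proof (induction q rule: trig_polys.induct)
    case (monomial d y)
    then show ?case
      using trig_polys.monomial[of "c * d" "x + y"]
      by (simp add: inner_add_left distrib_left exp_add mult_ac)
  next
    case (add q r)
    then show ?case
      using trig_polys.add by (fastforce simp: distrib_left)
  qed
next
  case (add p r)
  then show ?case
    using trig_polys.add by (fastforce simp: distrib_right)
qed

lemma trig_polys_power: "p \<in> trig_polys \<Longrightarrow> (\<lambda>\<omega>. p \<omega> ^ n) \<in> trig_polys"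
  by (induction n) (auto intro: trig_polys_const trig_polys_mult)

lemma trig_polys_prod:
  "(\<And>b. b \<in> B \<Longrightarrow> p b \<in> trig_polys) \<Longrightarrow> (\<lambda>\<omega>. \<Prod>b\<in>B. p b \<omega>) \<in> trig_polys"
  by (induction B rule: infinite_finite_induct) (auto intro: trig_polys_const trig_polys_mult)

lemma trig_polys_cos: "(\<lambda>\<omega>. of_real (cos (t * ((\<omega> - \<omega>0) \<bullet> b)))) \<in> trig_polys"
proof -
  let ?s = "t * (\<omega>0 \<bullet> b)"
  have "(\<lambda>\<omega>. exp (- \<i> * of_real ?s) / 2 * exp (\<i> * of_real ((t *\<^sub>R b) \<bullet> \<omega>)) +
          exp (\<i> * of_real ?s) / 2 * exp (\<i> * of_real ((- (t *\<^sub>R b)) \<bullet> \<omega>))) \<in> trig_polys"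
    by (intro trig_polys.intros)
  also have "(\<lambda>\<omega>. exp (- \<i> * of_real ?s) / 2 * exp (\<i> * of_real ((t *\<^sub>R b) \<bullet> \<omega>)) +
          exp (\<i> * of_real ?s) / 2 * exp (\<i> * of_real ((- (t *\<^sub>R b)) \<bullet> \<omega>))) =
        (\<lambda>\<omega>. of_real (cos (t * ((\<omega> - \<omega>0) \<bullet> b))))"
    by (simp add: cos_of_real[symmetric] cos_exp_eq exp_add[symmetric] fun_eq_iff algebra_simps inner_commute
        add_divide_distrib)
  finally show ?thesis .
qed

lemma trig_polys_obtain:
  assumes "p \<in> trig_polys"
  obtains n :: nat and c x where "p = (\<lambda>\<omega>. \<Sum>j<n. c j * exp (\<i> * of_real (x j \<bullet> \<omega>)))"
proof -
  have "\<exists>(n::nat) c x. p = (\<lambda>\<omega>. \<Sum>j<n. c j * exp (\<i> * of_real (x j \<bullet> \<omega>)))"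
    using assms
  proof (induction p rule: trig_polys.induct)
    case (monomial c x)
    show ?case
      by (rule exI[of _ 1], rule exI[of _ "\<lambda>_. c"], rule exI[of _ "\<lambda>_. x"]) simp
  next
    case (add p q)
    then obtain n m :: nat and c d x y where
      p: "p = (\<lambda>\<omega>. \<Sum>j<n. c j * exp (\<i> * of_real (x j \<bullet> \<omega>)))" and
      q: "q = (\<lambda>\<omega>. \<Sum>j<m. d j * exp (\<i> * of_real (y j \<bullet> \<omega>)))"
      by blast
    let ?c = "\<lambda>j. if j < n then c j else d (j - n)" and ?x = "\<lambda>j. if j < n then x j else y (j - n)"
    have split: "(\<Sum>j<n + m. h j) = (\<Sum>j<n. h j) + (\<Sum>j<m. h (n + j))" for h :: "nat \<Rightarrow> complex"
      by (induction m) (simp_all add: add.assoc)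
    have "(\<lambda>\<omega>. p \<omega> + q \<omega>) = (\<lambda>\<omega>. \<Sum>j<n + m. ?c j * exp (\<i> * of_real (?x j \<bullet> \<omega>)))"
      unfolding p q split by simp
    then show ?case
      by (intro exI[of _ "n + m"] exI[of _ ?c] exI[of _ ?x])
  qed
  then show ?thesis
    using that by blast
qed

section \<open>Positive semidefinite Fourier integrals\<close>

text \<open>The Fourier integral with the sign and normalisation of Bochner's theorem, for a signed density.\<close>

definition char_integral :: "('a :: euclidean_space \<Rightarrow> real) \<Rightarrow> 'a \<Rightarrow> complex" where
  "char_integral g h = (LINT \<omega>|lborel. exp (\<i> * of_real (h \<bullet> \<omega>)) * of_real (g \<omega>))"

lemma integrable_bounded_mult:
  fixes g :: "'a :: euclidean_space \<Rightarrow> real" and p :: "'a \<Rightarrow> complex"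
  assumes g: "integrable lborel g" and p: "continuous_on UNIV p" "\<And>\<omega>. norm (p \<omega>) \<le> K"
  shows "integrable lborel (\<lambda>\<omega>. p \<omega> * of_real (g \<omega>))"
proof (rule Bochner_Integration.integrable_bound)
  have [measurable]: "p \<in> borel_measurable borel" "g \<in> borel_measurable borel"
    using p(1) g by (auto intro: borel_measurable_continuous_onI)
  show "integrable lborel (\<lambda>\<omega>. K * g \<omega>)"
    using g by simp
  show "(\<lambda>\<omega>. p \<omega> * of_real (g \<omega>)) \<in> borel_measurable lborel"
    by measurable
  have "norm (p \<omega>) * \<bar>g \<omega>\<bar> \<le> \<bar>K\<bar> * \<bar>g \<omega>\<bar>" for \<omega>
    using p(2)[of \<omega>] by (intro mult_right_mono) auto
  then show "AE \<omega> in lborel. norm (p \<omega> * of_real (g \<omega>)) \<le> norm (K * g \<omega>)"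
    by (simp add: norm_mult abs_mult)
qed

lemma integrable_char:
  assumes "integrable lborel g"
  shows "integrable lborel (\<lambda>\<omega>. exp (\<i> * of_real (h \<bullet> \<omega>)) * of_real (g \<omega>))"
  using assms by (rule integrable_bounded_mult[where K = 1]) (auto intro!: continuous_intros)

text \<open>Expand \<open>\<bar>p\<bar>\<^sup>2 = p * cnj p\<close> for the trigonometric polynomial \<open>p\<close> with coefficients \<open>c\<close> and frequencies
  \<open>x\<close>. Read from right to left, a nonnegative density gives a positive semidefinite kernel; read from
  left to right, a positive semidefinite kernel tests the density against all \<open>\<bar>p\<bar>\<^sup>2\<close>.\<close>

lemma char_integral_quadratic_form:
  fixes g :: "'a :: euclidean_space \<Rightarrow> real" and c :: "nat \<Rightarrow> complex"
  assumes "integrable lborel g"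
  shows "(\<Sum>j<n. \<Sum>k<n. c j * cnj (c k) * char_integral g (x j - x k)) =
         of_real (LINT \<omega>|lborel. (cmod (\<Sum>j<n. c j * exp (\<i> * of_real (x j \<bullet> \<omega>))))\<^sup>2 * g \<omega>)"
proof -
  have sq: "of_real ((cmod (\<Sum>j<n. c j * exp (\<i> * of_real (x j \<bullet> \<omega>))))\<^sup>2 * g \<omega>) =
      (\<Sum>j<n. \<Sum>k<n. c j * cnj (c k) * (exp (\<i> * of_real ((x j - x k) \<bullet> \<omega>)) * of_real (g \<omega>)))"
    for \<omega>
  proof -
    let ?E = "\<lambda>j. exp (\<i> * of_real (x j \<bullet> \<omega>))"
    have "exp (\<i> * of_real ((x j - x k) \<bullet> \<omega>)) = ?E j * cnj (?E k)" for j k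
      by (simp add: exp_cnj exp_add[symmetric] inner_diff_left right_diff_distrib)
    then show ?thesis
      unfolding of_real_mult complex_norm_square cnj_sum sum_product
      unfolding sum_distrib_right by (intro sum.cong refl) (simp add: mult_ac)
  qed
  have "(\<Sum>j<n. \<Sum>k<n. c j * cnj (c k) * char_integral g (x j - x k)) =
        (LINT \<omega>|lborel. (\<Sum>j<n. \<Sum>k<n. c j * cnj (c k) * 
            (exp (\<i> * of_real ((x j - x k) \<bullet> \<omega>)) * of_real (g \<omega>))))"
    using integrable_char[OF assms] unfolding char_integral_def
    by (simp add: Bochner_Integration.integral_sum)
  then show ?thesis
    by (simp only: sq[symmetric] integral_complex_of_real)
qed

lemma psd_kernel_char_integral:
  fixes g :: "'a :: euclidean_space \<Rightarrow> real"
  assumes g: "integrable lborel g" and nonneg: "\<And>\<omega>. g \<omega> \<ge> 0"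
    and C: "\<And>h. of_real (C h) = char_integral g h"
  shows "psd_kernel (\<lambda>x y. C (x - y))"
  unfolding psd_kernel_def
proof (intro conjI allI)
  fix x y :: 'a
  \<comment> \<open>Symmetry comes from \<open>C\<close> being real: reflection conjugates the Fourier integral.\<close>
  have "char_integral g (- h) = cnj (char_integral g h)" for h
    unfolding char_integral_def
    by (subst Bochner_Integration.integral_cnj[symmetric], intro Bochner_Integration.integral_cong) (simp_all add: exp_cnj)
  then have "complex_of_real (C (- (x - y))) = cnj (of_real (C (x - y)))"
    by (simp only: C)
  then show "C (x - y) = C (y - x)"
    by simp
next
  fix n and v :: "nat \<Rightarrow> real" and x :: "nat \<Rightarrow> 'a"
  have "complex_of_real (\<Sum>i<n. \<Sum>j<n. v i * v j * C (x i - x j)) = of_real (LINT \<omega>|lborel. 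
      (cmod (\<Sum>j<n. of_real (v j) * exp (\<i> * of_real (x j \<bullet> \<omega>))))\<^sup>2 * g \<omega>)"
    by (subst char_integral_quadratic_form[OF g, symmetric]) (simp add: C)
  moreover have "(LINT \<omega>|lborel. 
      (cmod (\<Sum>j<n. of_real (v j) * exp (\<i> * of_real (x j \<bullet> \<omega>))))\<^sup>2 * g \<omega>) \<ge> 0"
    using nonneg by (intro Bochner_Integration.integral_nonneg) auto
  ultimately show "(\<Sum>i<n. \<Sum>j<n. v i * v j * C (x i - x j)) \<ge> 0"
    by (simp only: of_real_eq_iff)
qed

text \<open>As \<open>Re (a * cnj b) = Re a * Re b + Im a * Im b\<close>, the real part for a real kernel is the sum of two
  quadratic forms with real weights.\<close>

lemma psd_kernel_complex_form:
  fixes c :: "nat \<Rightarrow> complex"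
  assumes "psd_kernel K"
  shows "Re (\<Sum>j<n. \<Sum>k<n. c j * cnj (c k) * of_real (K (x j) (x k))) \<ge> 0"
proof -
  have "Re (\<Sum>j<n. \<Sum>k<n. c j * cnj (c k) * of_real (K (x j) (x k))) =
      (\<Sum>j<n. \<Sum>k<n. Re (c j) * Re (c k) * K (x j) (x k)) +
      (\<Sum>j<n. \<Sum>k<n. Im (c j) * Im (c k) * K (x j) (x k))"
    by (simp add: sum.distrib[symmetric] algebra_simps)
  also have "\<dots> \<ge> 0"
    using assms[unfolded psd_kernel_def, THEN conjunct2, rule_format, of "\<lambda>j. Re (c j)" x n]
      assms[unfolded psd_kernel_def, THEN conjunct2, rule_format, of "\<lambda>j. Im (c j)" x n]
    by simp
  finally show ?thesis .
qed

lemma trig_poly_integral_nonneg: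
  fixes g :: "'a :: euclidean_space \<Rightarrow> real"
  assumes g: "integrable lborel g" and C: "\<And>h. of_real (C h) = char_integral g h"
    and psd: "psd_kernel (\<lambda>x y. C (x - y))" and p: "p \<in> trig_polys"
  shows "(LINT \<omega>|lborel. (cmod (p \<omega>))\<^sup>2 * g \<omega>) \<ge> 0"
proof -
  obtain n :: nat and c and x :: "nat \<Rightarrow> 'a"
    where "p = (\<lambda>\<omega>. \<Sum>j<n. c j * exp (\<i> * of_real (x j \<bullet> \<omega>)))"
    using trig_polys_obtain[OF p] .
  then have "complex_of_real (LINT \<omega>|lborel. (cmod (p \<omega>))\<^sup>2 * g \<omega>) = 
      (\<Sum>j<n. \<Sum>k<n. c j * cnj (c k) * of_real (C (x j - x k)))"
    using char_integral_quadratic_form[OF g, where n = n and c = c and x = x] C by simp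
  then have "(LINT \<omega>|lborel. (cmod (p \<omega>))\<^sup>2 * g \<omega>) =
      Re (\<Sum>j<n. \<Sum>k<n. c j * cnj (c k) * of_real (C (x j - x k)))"
    by (metis Re_complex_of_real)
  then show ?thesis
    using psd_kernel_complex_form[OF psd, where n = n and c = c and x = x] by simp
qed

text \<open>The Gaussian centred at \<open>\<omega>0\<close> is the limit of the squares of the trigonometric polynomials
  \<open>\<Prod>\<^sub>b cos (\<surd>(T/n) ((\<omega> - \<omega>0) \<bullet> b))\<^sup>n\<close>, all bounded by \<open>1\<close>; dominated convergence carries the sign
  of their integrals over. Complex weights allow these polynomials to be centred at an arbitrary
  frequency.\<close>

lemma gaussian_integral_nonneg:
  fixes g :: "'a :: euclidean_space \<Rightarrow> real"
  assumes g: "integrable lborel g" and C: "\<And>h. of_real (C h) = char_integral g h"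
    and psd: "psd_kernel (\<lambda>x y. C (x - y))" and T: "T \<ge> 0"
  shows "(LINT \<omega>|lborel. exp (- T * (norm (\<omega> - \<omega>0))\<^sup>2) * g \<omega>) \<ge> 0"
proof -
  define p where "p n \<omega> = (\<Prod>b\<in>Basis. cos (sqrt (T / real n) * ((\<omega> - \<omega>0) \<bullet> b)) ^ n)" for n \<omega>
  have [measurable]: "g \<in> borel_measurable borel"
    using g by simp
  have [measurable]: "p n \<in> borel_measurable borel" for n
    unfolding p_def by measurable
  have bound: "(p n \<omega>)\<^sup>2 \<le> 1" for n \<omega>
  proof -
    have "\<bar>p n \<omega>\<bar> = (\<Prod>b\<in>Basis. \<bar>cos (sqrt (T / real n) * ((\<omega> - \<omega>0) \<bullet> b))\<bar> ^ n)"
      by (simp add: p_def abs_prod power_abs)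
    also have "\<dots> \<le> 1"
      by (intro prod_le_1) (auto intro: power_le_one)
    finally show ?thesis
      by (simp add: abs_square_le_1)
  qed
  have lim: "(\<lambda>n. (p n \<omega>)\<^sup>2) \<longlonglongrightarrow> exp (- T * (norm (\<omega> - \<omega>0))\<^sup>2)" for \<omega>
  proof -
    let ?u = "\<omega> - \<omega>0"
    have "(\<lambda>n. (p n \<omega>)\<^sup>2) \<longlonglongrightarrow> (\<Prod>b\<in>Basis. exp (- T * (?u \<bullet> b)\<^sup>2 / 2))\<^sup>2"
      unfolding p_def by (intro tendsto_intros cos_pow_tendsto_gaussian T)
    also have "(\<Prod>b\<in>Basis. exp (- T * (?u \<bullet> b)\<^sup>2 / 2)) = exp (- T * (norm ?u)\<^sup>2 / 2)"
    proof -
      have "(norm ?u)\<^sup>2 = (\<Sum>b\<in>Basis. (?u \<bullet> b)\<^sup>2)"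
        unfolding power2_norm_eq_inner by (subst euclidean_inner) (simp add: power2_eq_square)
      then show ?thesis
        by (simp add: exp_sum[symmetric] sum_distrib_left sum_divide_distrib sum_negf)
    qed
    also have "\<dots>\<^sup>2 = exp (- T * (norm ?u)\<^sup>2)"
      by (simp add: exp_double[symmetric])
    finally show ?thesis .
  qed
  have "(\<lambda>n. LINT \<omega>|lborel. (p n \<omega>)\<^sup>2 * g \<omega>) \<longlonglongrightarrow> 
        (LINT \<omega>|lborel. exp (- T * (norm (\<omega> - \<omega>0))\<^sup>2) * g \<omega>)"
  proof (rule integral_dominated_convergence[where w = "\<lambda>\<omega>. \<bar>g \<omega>\<bar>"])
    show "AE \<omega> in lborel. norm ((p n \<omega>)\<^sup>2 * g \<omega>) \<le> \<bar>g \<omega>\<bar>" for n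
      using bound by (auto simp: abs_mult intro!: mult_left_le_one_le)
    show "AE \<omega> in lborel. (\<lambda>n. (p n \<omega>)\<^sup>2 * g \<omega>) \<longlonglongrightarrow> exp (- T * (norm (\<omega> - \<omega>0))\<^sup>2) * g \<omega>"
      by (intro AE_I2 tendsto_mult lim tendsto_const)
  qed (use g in auto)
  moreover have "(LINT \<omega>|lborel. (p n \<omega>)\<^sup>2 * g \<omega>) \<ge> 0" for n
  proof -
    have "(\<lambda>\<omega>. \<Prod>b\<in>Basis. complex_of_real (cos (sqrt (T / real n) * ((\<omega> - \<omega>0) \<bullet> b))) ^ n) \<in> trig_polys"
      by (intro trig_polys_prod trig_polys_power trig_polys_cos)
    then have "(\<lambda>\<omega>. complex_of_real (p n \<omega>)) \<in> trig_polys"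
      by (simp add: p_def)
    from trig_poly_integral_nonneg[OF g C psd this] show ?thesis
      by simp
  qed
  ultimately show ?thesis
    by (intro LIMSEQ_le_const) auto
qed

text \<open>Narrow Gaussians single out the value at \<open>\<omega>0\<close>. If \<open>g\<close> were at most \<open>- e < 0\<close> within distance \<open>r\<close>, then
  after multiplication by \<open>exp (T s\<^sup>2)\<close>, where \<open>s < r\<close>, the weight would be at least \<open>1\<close> within distance
  \<open>s\<close> and would tend to \<open>0\<close> uniformly beyond distance \<open>r\<close> as \<open>T\<close> grows, making the average negative.\<close>

lemma nonneg_if_gaussian_averages_nonneg:
  fixes g :: "'a :: euclidean_space \<Rightarrow> real"
  assumes g: "integrable lborel g" and cont: "continuous_on UNIV g"
    and avg: "\<And>T. T \<ge> 0 \<Longrightarrow> (LINT \<omega>|lborel. exp (- T * (norm (\<omega> - \<omega>0))\<^sup>2) * g \<omega>) \<ge> 0"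
  shows "g \<omega>0 \<ge> 0"
proof (rule ccontr)
  assume neg: "\<not> g \<omega>0 \<ge> 0"
  define e where "e = - g \<omega>0 / 2"
  have e: "e > 0" using neg by (simp add: e_def)
  obtain r where r: "r > 0" "\<And>\<omega>. dist \<omega> \<omega>0 < r \<Longrightarrow> dist (g \<omega>) (g \<omega>0) < e"
    using cont e unfolding continuous_on_iff by (metis UNIV_I)
  have near: "g \<omega> \<le> - e" if "norm (\<omega> - \<omega>0) < r" for \<omega>
    using r(2)[of \<omega>] that by (auto simp: dist_norm e_def abs_less_iff field_simps)
  define s where "s = r / 2"
  have s: "0 < s" "s < r" using r by (auto simp: s_def)
  define B where "B = ball \<omega>0 s"
  define I where "I = (LINT \<omega>|lborel. \<bar>g \<omega>\<bar>)"
  have [measurable]: "g \<in> borel_measurable borel"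
    using g by simp
  have intB: "integrable lborel (indicat_real B)"
    using emeasure_bounded_finite[OF bounded_ball] by (simp add: B_def integrable_indicator_iff)
  have vol: "measure lborel B > 0"
    using s by (simp add: B_def content_ball_pos)
  have bound: "e * measure lborel B \<le> exp (- T * (r\<^sup>2 - s\<^sup>2)) * I" if T: "T \<ge> 0" for T
  proof -
    let ?E = "\<lambda>\<omega>. exp (- T * ((norm (\<omega> - \<omega>0))\<^sup>2 - s\<^sup>2))"
    have E: "?E \<omega> = exp (T * s\<^sup>2) * exp (- T * (norm (\<omega> - \<omega>0))\<^sup>2)" for \<omega>
      by (simp add: exp_add[symmetric] algebra_simps)
    have pointwise: "?E \<omega> * g \<omega> \<le> exp (- T * (r\<^sup>2 - s\<^sup>2)) * \<bar>g \<omega>\<bar> - e * indicat_real B \<omega>" for \<omega>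
    proof (cases "norm (\<omega> - \<omega>0) < r")
      case True
      have "?E \<omega> * g \<omega> \<le> - e * indicat_real B \<omega>"
      proof (cases "\<omega> \<in> B")
        case True
        then have "norm (\<omega> - \<omega>0) < s"
          by (simp add: B_def dist_norm norm_minus_commute)
        then have "(norm (\<omega> - \<omega>0))\<^sup>2 \<le> s\<^sup>2"
          by (intro power_mono) auto
        then have "?E \<omega> \<ge> 1"
          using T by (auto simp: mult_nonneg_nonpos)
        then have "?E \<omega> * g \<omega> \<le> 1 * g \<omega>"
          using near[OF \<open>norm (\<omega> - \<omega>0) < r\<close>] e by (intro mult_right_mono_neg) auto
        then show ?thesis
          using near[OF \<open>norm (\<omega> - \<omega>0) < r\<close>] True by simp
      next
        case False
        then show ?thesis
          using near[OF True] e by (simp add: mult_nonneg_nonpos)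
      qed
      also have "\<dots> \<le> exp (- T * (r\<^sup>2 - s\<^sup>2)) * \<bar>g \<omega>\<bar> - e * indicat_real B \<omega>"
        by simp
      finally show ?thesis .
    next
      case False
      then have "r\<^sup>2 \<le> (norm (\<omega> - \<omega>0))\<^sup>2"
        using r by (intro power_mono) auto
      then have "?E \<omega> \<le> exp (- T * (r\<^sup>2 - s\<^sup>2))"
        using T by (auto intro: mult_left_mono)
      then have "?E \<omega> * \<bar>g \<omega>\<bar> \<le> exp (- T * (r\<^sup>2 - s\<^sup>2)) * \<bar>g \<omega>\<bar>"
        by (intro mult_right_mono) auto
      moreover have "?E \<omega> * g \<omega> \<le> ?E \<omega> * \<bar>g \<omega>\<bar>"
        by (intro mult_left_mono) auto
      ultimately have "?E \<omega> * g \<omega> \<le> exp (- T * (r\<^sup>2 - s\<^sup>2)) * \<bar>g \<omega>\<bar>"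
        by (rule order_trans[rotated])
      moreover have "\<omega> \<notin> B"
        using False s by (simp add: B_def dist_norm norm_minus_commute)
      ultimately show ?thesis
        by simp
    qed
    have "integrable lborel (\<lambda>\<omega>. ?E \<omega> * g \<omega>)"
    proof (rule Bochner_Integration.integrable_bound)
      show "integrable lborel (\<lambda>\<omega>. exp (T * s\<^sup>2) * g \<omega>)"
        using g by simp
      show "AE \<omega> in lborel. norm (?E \<omega> * g \<omega>) \<le> norm (exp (T * s\<^sup>2) * g \<omega>)"
        using T by (auto simp: abs_mult algebra_simps intro!: mult_left_mono)
    qed measurable
    then have "(LINT \<omega>|lborel. ?E \<omega> * g \<omega>) \<le> 
        (LINT \<omega>|lborel. exp (- T * (r\<^sup>2 - s\<^sup>2)) * \<bar>g \<omega>\<bar> - e * indicat_real B \<omega>)"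
      using g intB by (intro integral_mono pointwise) auto
    also have "\<dots> = exp (- T * (r\<^sup>2 - s\<^sup>2)) * I - e * measure lborel B"
      using g intB by (simp add: I_def)
    finally have "(LINT \<omega>|lborel. ?E \<omega> * g \<omega>) \<le> exp (- T * (r\<^sup>2 - s\<^sup>2)) * I - e * measure lborel B" .
    moreover have "(LINT \<omega>|lborel. ?E \<omega> * g \<omega>) = 
        exp (T * s\<^sup>2) * (LINT \<omega>|lborel. exp (- T * (norm (\<omega> - \<omega>0))\<^sup>2) * g \<omega>)"
      unfolding E mult.assoc by simp
    ultimately show ?thesis
      using avg[OF T] by (smt (verit) exp_gt_zero mult_nonneg_nonneg)
  qed
  have "r\<^sup>2 - s\<^sup>2 > 0"
    using s by (simp add: power_strict_mono)
  then have "((\<lambda>T. exp (- T * (r\<^sup>2 - s\<^sup>2)) * I) \<longlongrightarrow> 0) at_top"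
    by real_asymp
  then have "e * measure lborel B \<le> 0"
  proof (rule tendsto_lowerbound)
    show "\<forall>\<^sub>F T in at_top. e * measure lborel B \<le> exp (- T * (r\<^sup>2 - s\<^sup>2)) * I"
      using eventually_ge_at_top[of 0] by eventually_elim (rule bound)
  qed simp
  then show False
    using e vol by (simp add: mult_le_0_iff)
qed

text \<open>The pointwise form of Bochner's criterion: continuity of the density upgrades almost everywhere
  to everywhere.\<close>

lemma psd_char_integral_iff:
  fixes g :: "'a :: euclidean_space \<Rightarrow> real"
  assumes "integrable lborel g" and "continuous_on UNIV g"
    and "\<And>h. of_real (C h) = char_integral g h"
  shows "psd_kernel (\<lambda>x y. C (x - y)) \<longleftrightarrow> (\<forall>\<omega>. g \<omega> \<ge> 0)"
proof
  assume "psd_kernel (\<lambda>x y. C (x - y))"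
  then show "\<forall>\<omega>. g \<omega> \<ge> 0"
    using nonneg_if_gaussian_averages_nonneg[OF assms(1,2)] gaussian_integral_nonneg[OF assms(1,3)]
    by blast
next
  assume "\<forall>\<omega>. g \<omega> \<ge> 0"
  then show "psd_kernel (\<lambda>x y. C (x - y))"
    using psd_kernel_char_integral[OF assms(1) _ assms(3)] by blast
qed

section \<open>Spectral densities of geometrically anisotropic covariances\<close>

lemma spectral_density_integrable:
  fixes f :: "real ^ 'd \<Rightarrow> real"
  assumes "spectral_density \<phi> f"
  shows "integrable lborel f"
proof (rule integrableI_nonneg)
  have f: "f \<in> borel_measurable borel"
    and fin: "finite_measure (density lborel (\<lambda>\<omega>. ennreal (f \<omega>)))"
    using assms by (simp_all add: spectral_density_def spectral_measure_def)
  then show "f \<in> borel_measurable lborel"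
    by simp
  show "AE \<omega> in lborel. 0 \<le> f \<omega>"
    using assms by (simp add: spectral_density_def)
  have "(\<integral>\<^sup>+\<omega>. ennreal (f \<omega>) \<partial>lborel) = emeasure (density lborel (\<lambda>\<omega>. ennreal (f \<omega>))) UNIV"
    using f by (simp add: emeasure_density)
  also have "\<dots> < \<infinity>"
    using finite_measure.emeasure_finite[OF fin] by (simp add: less_top)
  finally show "(\<integral>\<^sup>+\<omega>. ennreal (f \<omega>) \<partial>lborel) < \<infinity>" .
qed

lemma spectral_density_char_integral:
  fixes f :: "real ^ 'd \<Rightarrow> real"
  assumes "spectral_density \<phi> f"
  shows "of_real (\<phi> (norm h)) = char_integral f h"
proof -
  have f: "f \<in> borel_measurable borel" "\<And>\<omega>. f \<omega> \<ge> 0"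
    using assms by (simp_all add: spectral_density_def)
  have "of_real (\<phi> (norm h)) = (LINT \<omega>|density lborel (\<lambda>\<omega>. ennreal (f \<omega>)). exp (\<i> * of_real (h \<bullet> \<omega>)))"
    using assms by (simp add: spectral_density_def spectral_measure_def)
  also have "(LINT \<omega>|density lborel (\<lambda>\<omega>. ennreal (f \<omega>)). exp (\<i> * of_real (h \<bullet> \<omega>))) = char_integral f h"
    unfolding char_integral_def
    by (subst integral_density)
       (use f in \<open>auto simp: scaleR_conv_of_real mult.commute intro!: borel_measurable_continuous_onI continuous_intros\<close>)
  finally show ?thesis .
qed

lemma continuous_char_integral:
  fixes g :: "'a :: euclidean_space \<Rightarrow> real"
  assumes "integrable lborel g"
  shows "continuous_on UNIV (char_integral g)"
proof -
  have meas: "g \<in> borel_measurable borel"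
    using assms by simp
  have "isCont (char_integral g) h" for h
    unfolding continuous_at_sequentially o_def char_integral_def
  proof (intro allI impI)
    fix u :: "nat \<Rightarrow> 'a" assume u: "u \<longlonglongrightarrow> h"
    show "(\<lambda>n. LINT \<omega>|lborel. exp (\<i> * of_real (u n \<bullet> \<omega>)) * of_real (g \<omega>)) \<longlonglongrightarrow>
          (LINT \<omega>|lborel. exp (\<i> * of_real (h \<bullet> \<omega>)) * of_real (g \<omega>))"
    proof (rule integral_dominated_convergence[where w = "\<lambda>\<omega>. \<bar>g \<omega>\<bar>"])
      show "AE \<omega> in lborel. (\<lambda>n. exp (\<i> * of_real (u n \<bullet> \<omega>)) * of_real (g \<omega>)) \<longlonglongrightarrow>
          exp (\<i> * of_real (h \<bullet> \<omega>)) * of_real (g \<omega>)"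
        by (intro AE_I2 tendsto_intros u)
      show "integrable lborel (\<lambda>\<omega>. \<bar>g \<omega>\<bar>)"
        using assms by simp
    qed (use integrable_char[OF assms] in \<open>auto simp: norm_mult\<close>)
  qed
  then show ?thesis
    by (simp add: continuous_on_eq_continuous_at)
qed

text \<open>By the inversion formula a spectral density is itself the Fourier integral of an integrable
  function.\<close>

lemma spectral_density_continuous:
  fixes f :: "real ^ 'd \<Rightarrow> real"
  assumes "spectral_density \<phi> f"
  shows "continuous_on UNIV f"
proof -
  let ?\<phi> = "\<lambda>h :: real ^ 'd. \<phi> (norm h)"
  have int: "integrable lborel ?\<phi>"
    and "complex_of_real (f \<omega>) = complex_of_real (1 / (2 * pi) ^ CARD('d)) * char_integral ?\<phi> (- \<omega>)" for \<omega>
    using assms by (simp_all add: spectral_density_def char_integral_def)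
  then have f: "f = (\<lambda>\<omega>. Re (complex_of_real (1 / (2 * pi) ^ CARD('d)) * char_integral ?\<phi> (- \<omega>)))"
    by (metis Re_complex_of_real)
  have "continuous_on UNIV (\<lambda>\<omega>. char_integral ?\<phi> (- \<omega>))"
    by (rule continuous_on_compose2[OF continuous_char_integral[OF int]])
       (simp_all add: continuous_on_minus continuous_on_id)
  then show ?thesis
    by (subst f, intro continuous_on_Re continuous_on_mult_left)
qed

text \<open>With \<open>V\<^sup>T A V = 1\<close> and \<open>h = V u\<close> one has \<open>\<surd>(h \<bullet> A h) = \<parallel>u\<parallel>\<close> and \<open>\<surd>(\<omega> \<bullet> A\<^sup>-\<^sup>1 \<omega>) = \<parallel>V\<^sup>T \<omega>\<parallel>\<close>, because
  \<open>A\<^sup>-\<^sup>1 = V V\<^sup>T\<close>. Substituting \<open>V\<^sup>T \<omega>\<close> for the frequency turns \<open>u \<bullet> V\<^sup>T \<omega>\<close> into \<open>h \<bullet> \<omega>\<close> and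
  contributes the factor \<open>\<bar>det V\<bar> = 1 / \<surd>(det A)\<close>.\<close>

lemma anisotropic_spectral_density:
  fixes A :: "real ^ 'd ^ 'd"
  defines "q \<equiv> \<lambda>\<omega>. sqrt (\<omega> \<bullet> (matrix_inv A *v \<omega>))"
  assumes A: "sym_pos_def A" and dens: "spectral_density \<phi> (\<lambda>\<omega> :: real ^ 'd. fd (norm \<omega>))"
  shows "integrable lborel (\<lambda>\<omega>. fd (q \<omega>))" and "continuous_on UNIV (\<lambda>\<omega>. fd (q \<omega>))"
    and "fd (q \<omega>) \<ge> 0"
    and "of_real (\<phi> (sqrt (h \<bullet> (A *v h)))) = of_real (1 / sqrt (det A)) * char_integral (\<lambda>\<omega>. fd (q \<omega>)) h"
proof -
  let ?f = "\<lambda>\<omega> :: real ^ 'd. fd (norm \<omega>)"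
  obtain V :: "real ^ 'd ^ 'd" where V: "transpose V ** A ** V = mat 1"
    using pos_def_whitening[OF A] .
  note props = whitening_properties[OF V]
  have detV: "det V \<noteq> 0" and absV: "\<bar>det V\<bar> = 1 / sqrt (det A)"
    using props(1) sym_pos_def_det_pos[OF A]
    by (auto simp: field_simps real_sqrt_mult[symmetric] simp flip: real_sqrt_abs)
  have fd_q: "fd (q \<omega>) = ?f (transpose V *v \<omega>)" for \<omega>
  proof -
    have "\<omega> \<bullet> ((V ** transpose V) *v \<omega>) = (transpose V *v \<omega>) \<bullet> (transpose V *v \<omega>)"
      by (metis dot_lmul_matrix matrix_vector_mul_assoc transpose_matrix_vector)
    then show ?thesis
      by (simp add: q_def props(2) norm_eq_sqrt_inner)
  qed
  have f_meas[measurable]: "?f \<in> borel_measurable borel"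
    using dens by (simp add: spectral_density_def)
  have detVt: "det (transpose V) \<noteq> 0"
    using detV by simp
  show "integrable lborel (\<lambda>\<omega>. fd (q \<omega>))"
    unfolding fd_q using spectral_density_integrable[OF dens] integrable_lborel_matrix[OF detVt f_meas] by simp
  show "fd (q \<omega>) \<ge> 0"
    unfolding fd_q using dens by (simp add: spectral_density_def)
  show "continuous_on UNIV (\<lambda>\<omega>. fd (q \<omega>))"
    unfolding fd_q
    using continuous_on_compose2[OF spectral_density_continuous[OF dens]
        continuous_on_matrix_vector[of UNIV "transpose V"]] by simp
  define u where "u = (transpose V ** A) *v h"
  have "V ** (transpose V ** A) = mat 1"
    using V matrix_left_right_inverse by blast
  then have h: "V *v u = h"
    by (simp add: u_def matrix_vector_mul_assoc)
  have adjoint: "u \<bullet> (transpose V *v \<omega>) = h \<bullet> \<omega>" for \<omega>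
    unfolding transpose_matrix_vector inner_commute[of u] dot_lmul_matrix h by (rule inner_commute)
  have "h \<bullet> (A *v h) = u \<bullet> u"
    using props(3)[of u] h by simp
  then have "of_real (\<phi> (sqrt (h \<bullet> (A *v h)))) = char_integral ?f u"
    using spectral_density_char_integral[OF dens, of u] by (simp add: norm_eq_sqrt_inner)
  also have "\<dots> = \<bar>det (transpose V)\<bar> *\<^sub>R (LINT \<omega>|lborel. 
      exp (\<i> * of_real (u \<bullet> (transpose V *v \<omega>))) * of_real (?f (transpose V *v \<omega>)))"
    unfolding char_integral_def
  proof (rule integral_lborel_matrix[OF detVt], rule borel_measurable_times)
    show "(\<lambda>\<omega>. exp (\<i> * complex_of_real (u \<bullet> \<omega>))) \<in> borel_measurable borel"
      by (intro borel_measurable_continuous_onI continuous_intros)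
  qed simp
  also have "\<dots> = of_real (1 / sqrt (det A)) * char_integral (\<lambda>\<omega>. fd (q \<omega>)) h"
    unfolding adjoint char_integral_def fd_q det_transpose absV scaleR_conv_of_real ..
  finally show "of_real (\<phi> (sqrt (h \<bullet> (A *v h)))) = 
      of_real (1 / sqrt (det A)) * char_integral (\<lambda>\<omega>. fd (q \<omega>)) h" .
qed

lemma char_integral_diff:
  assumes "integrable lborel f" "integrable lborel g"
  shows "char_integral (\<lambda>\<omega>. a * f \<omega> - b * g \<omega>) h = of_real a * char_integral f h - of_real b * char_integral g h"
proof -
  have "char_integral (\<lambda>\<omega>. a * f \<omega> - b * g \<omega>) h = (LINT \<omega>|lborel. 
      of_real a * (exp (\<i> * of_real (h \<bullet> \<omega>)) * of_real (f \<omega>)) - of_real b * (exp (\<i> * of_real (h \<bullet> \<omega>)) * of_real (g \<omega>)))"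
    unfolding char_integral_def by (simp add: algebra_simps)
  then show ?thesis
    using integrable_char[OF assms(1)] integrable_char[OF assms(2)]
    by (simp add: char_integral_def)
qed

section \<open>The criterion as a supremum of ratios\<close>

text \<open>The conventions of extended real division fit the cross-multiplied inequality: where \<open>v\<close> vanishes,
  the ratio is \<open>\<infinity>\<close> if \<open>u > 0\<close>, and the inequality then fails for \<open>c > 0\<close>; it is \<open>0\<close> if \<open>u = 0\<close>, and the
  inequality then holds trivially. For \<open>c = 0\<close> the product is \<open>0\<close> even if the supremum is \<open>\<infinity>\<close>.\<close>

lemma ereal_SUP_ratio_le_iff:
  fixes u v :: "'a \<Rightarrow> real"
  assumes "b \<ge> 0" "c \<ge> 0" "\<And>x. u x \<ge> 0" "\<And>x. v x \<ge> 0"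
  shows "ereal c * (SUP x. ereal (u x) / ereal (v x)) \<le> ereal b \<longleftrightarrow> (\<forall>x. c * u x \<le> b * v x)"
proof (cases "c = 0")
  case True
  then show ?thesis
    using assms by (simp add: zero_ereal_def[symmetric])
next
  case False
  then have c: "c > 0" using assms by simp
  have ratio: "ereal c * (ereal (u x) / ereal (v x)) \<le> ereal b \<longleftrightarrow> c * u x \<le> b * v x" for x
  proof (cases "v x = 0")
    case True
    then show ?thesis
      using c assms(1) assms(3)[of x] by (cases "u x = 0") (auto simp: divide_ereal_def mult_le_0_iff)
  next
    case False
    then show ?thesis
      using assms(4)[of x] by (simp add: divide_ereal_def field_simps)
  qed
  have "ereal c * (SUP x. ereal (u x) / ereal (v x)) = (SUP x. ereal c * (ereal (u x) / ereal (v x)))"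
    using c by (intro Sup_ereal_mult_left') auto
  then show ?thesis
    by (simp only: SUP_le_iff ratio ball_UNIV)
qed

theorem proposition3p1:
  fixes \<phi> fd :: "real \<Rightarrow> real"
    and b1 b2 :: real
    and A1 A2 :: "real ^ 'd ^ 'd"
  assumes "\<phi> \<in> Phi TYPE('d)"
    and "radial_spectral_density TYPE('d) \<phi> fd"
    and "b1 \<ge> 0" and "b2 \<ge> 0"
    and "sym_pos_def A1" and "sym_pos_def A2"
  shows "stationary_covariance
           (\<lambda>h :: real ^ 'd. b1 * \<phi> (sqrt (h \<bullet> (A1 *v h))) - b2 * \<phi> (sqrt (h \<bullet> (A2 *v h))))
         \<longleftrightarrow>
         ereal b1 \<ge> ereal (b2 * (sqrt (det A1) / sqrt (det A2))) * sup_density_ratio fd A1 A2"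
proof -
  define f1 where "f1 = (\<lambda>\<omega>. fd (sqrt (\<omega> \<bullet> (matrix_inv A1 *v \<omega>))))"
  define f2 where "f2 = (\<lambda>\<omega>. fd (sqrt (\<omega> \<bullet> (matrix_inv A2 *v \<omega>))))"
  define C where "C h = b1 * \<phi> (sqrt (h \<bullet> (A1 *v h))) - b2 * \<phi> (sqrt (h \<bullet> (A2 *v h)))" for h
  \<comment> \<open>The spectral density of \<open>C\<close>, which may take negative values.\<close>
  define g where "g \<omega> = b1 / sqrt (det A1) * f1 \<omega> - b2 / sqrt (det A2) * f2 \<omega>" for \<omega>
  have dens: "spectral_density \<phi> (\<lambda>\<omega> :: real ^ 'd. fd (norm \<omega>))"
    using assms(2) by (simp add: radial_spectral_density_def)
  note F1 = anisotropic_spectral_density[OF assms(5) dens, folded f1_def]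
  note F2 = anisotropic_spectral_density[OF assms(6) dens, folded f2_def]
  have det: "sqrt (det A1) > 0" "sqrt (det A2) > 0"
    using assms(5,6) by (simp_all add: sym_pos_def_det_pos)
  have "integrable lborel g"
    unfolding g_def[abs_def]
    by (intro Bochner_Integration.integrable_diff integrable_mult_right F1(1) F2(1))
  moreover have "continuous_on UNIV g"
    unfolding g_def[abs_def] by (intro continuous_on_diff continuous_on_mult_left F1(2) F2(2))
  moreover have C: "of_real (C h) = char_integral g h" for h
    unfolding C_def g_def[abs_def] char_integral_diff[OF F1(1) F2(1)]
    by (simp only: of_real_diff of_real_mult F1(4) F2(4)) (simp add: divide_inverse of_real_inverse)
  ultimately have "psd_kernel (\<lambda>x y. C (x - y)) \<longleftrightarrow> (\<forall>\<omega>. g \<omega> \<ge> 0)"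
    by (rule psd_char_integral_iff)
  also have "\<dots> \<longleftrightarrow> (\<forall>\<omega>. b2 * (sqrt (det A1) / sqrt (det A2)) * f2 \<omega> \<le> b1 * f1 \<omega>)"
    using det by (simp add: g_def field_simps)
  also have "\<dots> \<longleftrightarrow> ereal (b2 * (sqrt (det A1) / sqrt (det A2))) * 
      (SUP \<omega>. ereal (f2 \<omega>) / ereal (f1 \<omega>)) \<le> ereal b1"
    using assms(3,4) det F1(3) F2(3)
    by (intro ereal_SUP_ratio_le_iff[symmetric]) (simp_all add: f1_def f2_def)
  finally show ?thesis
    unfolding stationary_covariance_def C_def f1_def f2_def sup_density_ratio_def .
qed

end
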